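(* Let $n \ge 1$ and let $A_1,\dots,A_n,B_1,\dots,B_n$ be formulas of the propositional calculus. If $\vdash A_i \supset B_i$ for every $i = 1,\dots,n$, then 1) $\vdash A_1 \wedge A_2 \wedge \dots \wedge A_n \supset B_1 \wedge B_2 \wedge \dots \wedge B_n$, and 2) $\vdash A_1 \vee A_2 \vee \dots \vee A_n \supset B_1 \vee B_2 \vee \dots \vee B_n$.
   Context: Formulas are those of propositional logic built from propositional variables with the connectives $\wedge$, $\vee$, $\supset$ (implication) and $\overline{\,\cdot\,}$ (negation); $\wedge$ and $\vee$ bind more strongly than $\supset$. The notation $\vdash F$ means that $F$ is deducible (without hypotheses) in the Hilbert-style propositional calculus whose axioms are all instances, for arbitrary formulas $A,B,C$, of the schemes: I. a) $A \supset (B \supset A)$; b) $(A \supset (B \supset C)) \supset ((A \supset B) \supset (A \supset C))$. II. a) $A \wedge B \supset A$; b) $A \wedge B \supset B$; c) $(A \supset B) \supset ((A \supset C) \supset (A \supset B \wedge C))$. III. a) $A \supset A \vee B$; b) $B \supset A \vee B$; c) $(A \supset C) \supset ((B \supset C) \supset (A \vee B \supset C))$. IV. a) $(A \supset B) \supset (\overline{B} \supset \overline{A})$; b) $A \supset \overline{\overline{A}}$; c) $\overline{\overline{A}} \supset A$. The inference rule is modus ponens: from $\vdash A$ and $\vdash A \supset B$ infer $\vdash B$. Iterated conjunctions and disjunctions are bracketed to the left: $F_1 \wedge \dots \wedge F_{n+1}$ is $(F_1 \wedge \dots \wedge F_n) \wedge F_{n+1}$, and similarly for $\vee$; for $n=1$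 they are just $F_1$. *)

theory Defs
  imports Main
begin

datatype 'v form =
    Var 'v
  | And "'v form" "'v form"  (infixl \<open>\<^bold>\<and>\<close> 75)
  | Or "'v form" "'v form"  (infixl \<open>\<^bold>\<or>\<close> 75)
  | Imp "'v form" "'v form"  (infix \<open>\<^bold>\<supset>\<close> 70)
  | Neg "'v form"  (\<open>\<^bold>\<not> _\<close> [80] 80)

inductive deducible :: "'v form \<Rightarrow> bool"  (\<open>\<turnstile> _\<close> [60] 60) where
  Ia:   "\<turnstile> A \<^bold>\<supset> (B \<^bold>\<supset> A)"
| Ib:   "\<turnstile> (A \<^bold>\<supset> (B \<^bold>\<supset> C)) \<^bold>\<supset> ((A \<^bold>\<supset> B) \<^bold>\<supset> (A \<^bold>\<supset> C))"
| IIa:  "\<turnstile> A \<^bold>\<and> B \<^bold>\<supset> A"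
| IIb:  "\<turnstile> A \<^bold>\<and> B \<^bold>\<supset> B"
| IIc:  "\<turnstile> (A \<^bold>\<supset> B) \<^bold>\<supset> ((A \<^bold>\<supset> C) \<^bold>\<supset> (A \<^bold>\<supset> B \<^bold>\<and> C))"
| IIIa: "\<turnstile> A \<^bold>\<supset> A \<^bold>\<or> B"
| IIIb: "\<turnstile> B \<^bold>\<supset> A \<^bold>\<or> B"
| IIIc: "\<turnstile> (A \<^bold>\<supset> C) \<^bold>\<supset> ((B \<^bold>\<supset> C) \<^bold>\<supset> (A \<^bold>\<or> B \<^bold>\<supset> C))"
| IVa:  "\<turnstile> (A \<^bold>\<supset> B) \<^bold>\<supset> (\<^bold>\<not> B \<^bold>\<supset> \<^bold>\<not> A)"
| IVb:  "\<turnstile> A \<^bold>\<supset> \<^bold>\<not> \<^bold>\<not> A"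
| IVc:  "\<turnstile> \<^bold>\<not> \<^bold>\<not> A \<^bold>\<supset> A"
| MP:   "\<turnstile> A \<Longrightarrow> \<turnstile> A \<^bold>\<supset> B \<Longrightarrow> \<turnstile> B"

(* Families are indexed from 1; the empty conjunction and disjunction (n = 0) are left unspecified. *)

fun big_and :: "(nat \<Rightarrow> 'v form) \<Rightarrow> nat \<Rightarrow> 'v form" where
  "big_and F (Suc 0) = F 1"
| "big_and F (Suc (Suc n)) = big_and F (Suc n) \<^bold>\<and> F (Suc (Suc n))"

fun big_or :: "(nat \<Rightarrow> 'v form) \<Rightarrow> nat \<Rightarrow> 'v form" where
  "big_or F (Suc 0) = F 1"
| "big_or F (Suc (Suc n)) = big_or F (Suc n) \<^bold>\<or> F (Suc (Suc n))"

end

theory Submission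
  imports Defs
begin

text \<open>
  Both claims follow by induction on \<open>n\<close> from the monotonicity of the binary connectives
  (\<open>and_mono\<close>, \<open>or_mono\<close>). Monotonicity needs only the transitivity of implication, which
  comes from schemes I, together with the facts that conjunction is a greatest lower bound
  (schemes II) and disjunction a least upper bound (schemes III) for the order
  \<open>\<turnstile> A \<^bold>\<supset> B\<close>. Negation plays no role.
\<close>

lemma imp_trans:
  assumes "\<turnstile> A \<^bold>\<supset> B" and "\<turnstile> B \<^bold>\<supset> C"
  shows "\<turnstile> A \<^bold>\<supset> C"
proof -
  have "\<turnstile> A \<^bold>\<supset> (B \<^bold>\<supset> C)"
    using assms(2) Ia by (rule MP)
  then have "\<turnstile> (A \<^bold>\<supset> B) \<^bold>\<supset> (A \<^bold>\<supset> C)"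
    using Ib by (rule MP)
  with assms(1) show ?thesis by (rule MP)
qed

lemma imp_andI:
  assumes "\<turnstile> A \<^bold>\<supset> B" and "\<turnstile> A \<^bold>\<supset> C"
  shows "\<turnstile> A \<^bold>\<supset> B \<^bold>\<and> C"
  using assms(2) MP[OF assms(1) IIc] by (rule MP)

lemma or_impI:
  assumes "\<turnstile> A \<^bold>\<supset> C" and "\<turnstile> B \<^bold>\<supset> C"
  shows "\<turnstile> A \<^bold>\<or> B \<^bold>\<supset> C"
  using assms(2) MP[OF assms(1) IIIc] by (rule MP)

lemma and_mono:
  assumes "\<turnstile> A \<^bold>\<supset> B" and "\<turnstile> C \<^bold>\<supset> D"
  shows "\<turnstile> A \<^bold>\<and> C \<^bold>\<supset> B \<^bold>\<and> D"
  using imp_trans[OF IIa assms(1)] imp_trans[OF IIb assms(2)] by (rule imp_andI)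

lemma or_mono:
  assumes "\<turnstile> A \<^bold>\<supset> B" and "\<turnstile> C \<^bold>\<supset> D"
  shows "\<turnstile> A \<^bold>\<or> C \<^bold>\<supset> B \<^bold>\<or> D"
  using imp_trans[OF assms(1) IIIa] imp_trans[OF assms(2) IIIb] by (rule or_impI)

theorem mainTheorem1:
  fixes n :: nat and A B :: "nat \<Rightarrow> 'v form"
  assumes "n \<ge> 1"
    and "\<And>i. 1 \<le> i \<Longrightarrow> i \<le> n \<Longrightarrow> \<turnstile> A i \<^bold>\<supset> B i"
  shows "(\<turnstile> big_and A n \<^bold>\<supset> big_and B n) \<and> (\<turnstile> big_or A n \<^bold>\<supset> big_or B n)"
  using assms
proof (induction n rule: nat_induct_at_least)
  case base
  then show ?case by simp
next
  case (Suc n)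
  have IH: "\<turnstile> big_and A n \<^bold>\<supset> big_and B n" "\<turnstile> big_or A n \<^bold>\<supset> big_or B n"
    using Suc.IH Suc.prems by simp_all
  have last: "\<turnstile> A (Suc n) \<^bold>\<supset> B (Suc n)"
    using Suc.prems by simp
  (* The recursion equations for the iterated connectives need an argument of the form Suc (Suc m). *)
  from \<open>n \<ge> 1\<close> obtain m where "n = Suc m"
    by (cases n) simp_all
  then show ?case
    using and_mono[OF IH(1) last] or_mono[OF IH(2) last] by simp
qed

end
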